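(* Let $0<r\le 1$ be a real number such that $1/r$ is not an integer, and let $k=\lfloor 1/r\rfloor$. For a positive integer $n$ let $m=n-k\lceil rn\rceil$ and $l=(k+1)\lceil rn\rceil-n$. For positive integers $\beta,\alpha$ let \[ q(\beta,\alpha)=\min\sum_i \omega(\alpha\beta_i,\alpha), \] where the minimum is taken over all ways of writing $\beta=\sum_i\beta_i$ as a sum of positive integers $\beta_i$. Then for all sufficiently large $n$, \[ Q(n,\lceil rn\rceil)\le q(l,k)+q(m,k+1). \]
   Context: All graphs are finite and simple; $\omega(G)$, $\alpha(G)$, $\chi(G)$ denote clique number, independence number and chromatic number, and $|G|$ the number of vertices. For positive integers $n,k$, $\omega(n,k)=\min\{\omega(G): |G|=n \text{ and } \alpha(G)\le k\}$. For positive integers $n,c$, $Q(n,c)=\min\{\omega(G): |G|=n \text{ and } \chi(G)=c\}$. (For large $n$ the quantities $l$ and $m$ are positive integers, so the expressions are defined.) *)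

theory Defs
  imports Complex_Main "HOL-Library.Ramsey" "HOL-Library.Multiset"
begin

definition simple_graph :: "'a set \<Rightarrow> 'a set set \<Rightarrow> bool" where
  "simple_graph V E \<longleftrightarrow> finite V \<and> E \<subseteq> [V]\<^bsup>2\<^esup>"

text \<open>The predicates \<open>clique\<close> and \<open>indep\<close> are those of \<^theory>\<open>HOL-Library.Ramsey\<close>.\<close>

definition clique_number :: "'a set \<Rightarrow> 'a set set \<Rightarrow> nat" where
  "clique_number V E = Max {card K | K. K \<subseteq> V \<and> clique K E}"

definition independence_number :: "'a set \<Rightarrow> 'a set set \<Rightarrow> nat" where
  "independence_number V E = Max {card S | S. S \<subseteq> V \<and> indep S E}"

definition colorable :: "'a set \<Rightarrow> 'a set set \<Rightarrow> nat \<Rightarrow> bool" where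
  "colorable V E c \<longleftrightarrow>
     (\<exists>f \<in> V \<rightarrow> {..<c}. \<forall>u\<in>V. \<forall>v\<in>V. {u, v} \<in> E \<longrightarrow> f u \<noteq> f v)"

definition chromatic_number :: "'a set \<Rightarrow> 'a set set \<Rightarrow> nat" where
  "chromatic_number V E = (LEAST c. colorable V E c)"

text \<open>In the next two definitions the vertices are natural numbers. This loses nothing,
  since every finite graph is isomorphic to one of this kind.\<close>

definition omega_min :: "nat \<Rightarrow> nat \<Rightarrow> nat" where
  "omega_min n k =
     (LEAST w. \<exists>(V :: nat set) E. simple_graph V E \<and> card V = n \<and>
                 independence_number V E \<le> k \<and> w = clique_number V E)"

definition Q_min :: "nat \<Rightarrow> nat \<Rightarrow> nat" where
  "Q_min n c =
     (LEAST w. \<exists>(V :: nat set) E. simple_graph V E \<and> card V = n \<and>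
                 chromatic_number V E = c \<and> w = clique_number V E)"

text \<open>The first argument of \<open>q_min\<close> is the number being partitioned.\<close>

definition q_min :: "nat \<Rightarrow> nat \<Rightarrow> nat" where
  "q_min b a =
     (LEAST s. \<exists>B :: nat multiset. (\<forall>x\<in>#B. 0 < x) \<and> \<Sum>\<^sub># B = b \<and>
                 s = (\<Sum>x\<in>#B. omega_min (a * x) a))"

text \<open>The three minima are attained whenever the arguments are meaningful.\<close>

lemma omega_min_attained:
  assumes "0 < k"
  shows "\<exists>(V :: nat set) E. simple_graph V E \<and> card V = n \<and>
           independence_number V E \<le> k \<and> omega_min n k = clique_number V E"
  unfolding omega_min_def
proof (rule LeastI_ex)
  let ?V = "{..<n}" and ?E = "[{..<n}]\<^bsup>2\<^esup>"
  have le: "card S \<le> k" if "S \<subseteq> ?V" "indep S ?E" for S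
  proof -
    have "\<forall>x\<in>S. \<forall>y\<in>S. x = y"
      using that unfolding indep_def by (meson doubleton_in_nsets_2 subsetD)
    then have "card S \<le> 1"
      using that(1) finite_subset by (metis One_nat_def card_le_Suc0_iff_eq finite_lessThan)
    with assms show ?thesis by simp
  qed
  let ?A = "{card S | S. S \<subseteq> ?V \<and> indep S ?E}"
  have "finite ?A"
    by (rule finite_subset[of _ "{..k}"]) (use le in auto)
  moreover have "?A \<noteq> {}" using null_indep by blast
  ultimately have "independence_number ?V ?E \<le> k"
    unfolding independence_number_def using le by (subst Max_le_iff) auto
  then show "\<exists>w (V :: nat set) E. simple_graph V E \<and> card V = n \<and>
      independence_number V E \<le> k \<and> w = clique_number V E"
    by (intro exI[of _ "clique_number ?V ?E"] exI[of _ ?V] exI[of _ ?E])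
      (simp add: simple_graph_def)
qed

lemma Q_min_attained:
  assumes "0 < c" "c \<le> n"
  shows "\<exists>(V :: nat set) E. simple_graph V E \<and> card V = n \<and>
           chromatic_number V E = c \<and> Q_min n c = clique_number V E"
  unfolding Q_min_def
proof (rule LeastI_ex)
  let ?V = "{..<n}"
  let ?E = "[{..<c}]\<^bsup>2\<^esup>"
  have "chromatic_number ?V ?E = c"
    unfolding chromatic_number_def
  proof (rule Least_equality)
    show "colorable ?V ?E c"
      unfolding colorable_def
      by (rule bexI[of _ "\<lambda>v. if v < c then v else 0"]) (use assms in auto)
  next
    fix d assume "colorable ?V ?E d"
    then obtain f where f: "f \<in> ?V \<rightarrow> {..<d}"
      and ne: "\<forall>u\<in>?V. \<forall>v\<in>?V. {u, v} \<in> ?E \<longrightarrow> f u \<noteq> f v"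
      unfolding colorable_def by blast
    have "inj_on f {..<c}"
      unfolding inj_on_def using ne assms
      by (metis doubleton_in_nsets_2 lessThan_iff order_less_le_trans)
    moreover have "f ` {..<c} \<subseteq> {..<d}" using f assms by auto
    ultimately show "c \<le> d" using card_inj_on_le[of f "{..<c}" "{..<d}"] by simp
  qed
  moreover have "?E \<subseteq> [?V]\<^bsup>2\<^esup>" using assms by (intro nsets_mono) auto
  ultimately show "\<exists>w (V :: nat set) E. simple_graph V E \<and> card V = n \<and>
      chromatic_number V E = c \<and> w = clique_number V E"
    by (intro exI[of _ "clique_number ?V ?E"] exI[of _ ?V] exI[of _ ?E])
      (simp add: simple_graph_def)
qed

lemma q_min_attained:
  "\<exists>B :: nat multiset. (\<forall>x\<in>#B. 0 < x) \<and> \<Sum>\<^sub># B = b \<and>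
     q_min b a = (\<Sum>x\<in>#B. omega_min (a * x) a)"
  unfolding q_min_def
proof (rule LeastI_ex)
  let ?B = "replicate_mset b (1 :: nat)"
  have "(\<forall>x\<in>#?B. 0 < x) \<and> \<Sum>\<^sub># ?B = b"
    by (simp add: sum_mset_replicate_mset)
  then show "\<exists>s (B :: nat multiset). (\<forall>x\<in>#B. 0 < x) \<and> \<Sum>\<^sub># B = b \<and>
      s = (\<Sum>x\<in>#B. omega_min (a * x) a)"
    by blast
qed

text \<open>For large \<open>n\<close> the truncated subtractions defining \<open>m\<close> and \<open>l\<close> in the theorem are
  ordinary ones, with positive results.\<close>

lemma eventually_l_m_positive:
  fixes r :: real and k :: nat
  assumes "0 < r" "r \<le> 1" "1 / r \<notin> \<int>" "k = nat \<lfloor>1 / r\<rfloor>"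
  shows "\<forall>\<^sub>F n in sequentially.
           k * nat \<lceil>r * real n\<rceil> < n \<and> n < (k + 1) * nat \<lceil>r * real n\<rceil>"
proof -
  have k: "real k = of_int \<lfloor>1 / r\<rfloor>" using assms by simp
  have "real k \<noteq> 1 / r" using assms(3) k by (metis Ints_of_int)
  then have "real k < 1 / r" unfolding k by linarith
  then have kr: "real k * r < 1" using assms(1) by (simp add: field_simps)
  have "1 / r < real k + 1" unfolding k by linarith
  then have kr': "1 < (real k + 1) * r" using assms(1) by (simp add: field_simps)
  have "\<forall>\<^sub>F n in sequentially. real k / (1 - real k * r) < real n"
    using filterlim_real_sequentially filterlim_at_top_dense by blast
  moreover have "\<forall>\<^sub>F n in sequentially. 0 < n" by (rule eventually_gt_at_top)
  ultimately show ?thesis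
  proof eventually_elim
    case (elim n)
    let ?c = "nat \<lceil>r * real n\<rceil>"
    have c: "real ?c = of_int \<lceil>r * real n\<rceil>" using assms(1) by simp
    have "real k < real n * (1 - real k * r)"
      using elim(1) kr by (simp add: field_simps)
    then have "real k * (r * real n + 1) < real n" by (simp add: algebra_simps)
    moreover have "real k * real ?c \<le> real k * (r * real n + 1)"
      unfolding c by (intro mult_left_mono) linarith+
    ultimately have "real (k * ?c) < real n" by simp
    then have 1: "k * ?c < n" by linarith
    have "real n < (real k + 1) * r * real n" using kr' elim(2) by simp
    also have "\<dots> \<le> (real k + 1) * real ?c"
      unfolding c mult.assoc by (intro mult_left_mono) linarith+
    finally have "real n < real ((k + 1) * ?c)" by (simp add: algebra_simps)
    then have "n < (k + 1) * ?c" by linarith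
    with 1 show ?case by simp
  qed
qed

end

theory Submission
  imports Defs
begin

text \<open>Join the extremal graphs for all parts of optimal partitions of \<open>l\<close> and \<open>m\<close>.
  Clique numbers add up under joins, and so do chromatic numbers. A graph on \<open>k * x\<close>
  vertices without independent sets of more than \<open>k\<close> vertices has chromatic number at least \<open>x\<close>,
  so the join has \<open>k l + (k + 1) m = n\<close> vertices and chromatic number at least
  \<open>l + m = \<lceil>r n\<rceil>\<close>. Since deleting an edge lowers the chromatic number by at most one and
  never raises the clique number, some spanning subgraph has chromatic number exactly
  \<open>\<lceil>r n\<rceil>\<close>.\<close>

section \<open>Bounds for clique, independence and chromatic numbers\<close>

lemma finite_card_subsets:
  assumes "finite V"
  shows "finite {card K | K. K \<subseteq> V \<and> P K}"
  by (rule finite_subset[of _ "{..card V}"]) (use assms card_mono in auto)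

lemma card_le_clique_number:
  assumes "finite V" "K \<subseteq> V" "clique K E"
  shows "card K \<le> clique_number V E"
  unfolding clique_number_def
  by (rule Max_ge) (use assms finite_card_subsets in auto)

lemma clique_number_le:
  assumes "finite V" "\<And>K. K \<subseteq> V \<Longrightarrow> clique K E \<Longrightarrow> card K \<le> s"
  shows "clique_number V E \<le> s"
proof -
  have "{card K | K. K \<subseteq> V \<and> clique K E} \<noteq> {}"
    by (auto simp: clique_def intro: exI[of _ "{}"])
  then show ?thesis
    unfolding clique_number_def using assms finite_card_subsets[OF assms(1)]
    by (subst Max_le_iff) auto
qed

lemma clique_number_mono:
  assumes "finite V" "E \<subseteq> E'"
  shows "clique_number V E \<le> clique_number V E'"
  by (rule clique_number_le[OF assms(1)], rule card_le_clique_number[OF assms(1)])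
    (use assms(2) in \<open>auto simp: clique_def\<close>)

lemma card_le_independence_number:
  assumes "finite V" "S \<subseteq> V" "indep S E"
  shows "card S \<le> independence_number V E"
  unfolding independence_number_def
  by (rule Max_ge) (use assms finite_card_subsets in auto)

lemma chromatic_number_le_card_image:
  assumes "finite V" "\<And>u v. u \<in> V \<Longrightarrow> v \<in> V \<Longrightarrow> {u, v} \<in> E \<Longrightarrow> f u \<noteq> f v"
  shows "chromatic_number V E \<le> card (f ` V)"
proof -
  obtain g where g: "bij_betw g (f ` V) {..<card (f ` V)}"
    using assms(1) ex_bij_betw_finite_nat[of "f ` V"] by (auto simp: atLeast0LessThan)
  have "colorable V E (card (f ` V))"
    unfolding colorable_def
  proof (intro bexI[of _ "g \<circ> f"] ballI impI)
    show "g \<circ> f \<in> V \<rightarrow> {..<card (f ` V)}"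
      using g by (auto simp: bij_betw_def)
    show "(g \<circ> f) u \<noteq> (g \<circ> f) v" if "u \<in> V" "v \<in> V" "{u, v} \<in> E" for u v
      using assms(2)[OF that] g that by (auto simp: bij_betw_def inj_on_def)
  qed
  then show ?thesis unfolding chromatic_number_def by (rule Least_le)
qed

text \<open>The set under \<open>LEAST\<close> is nonempty: an injective colouring with
  \<open>card V\<close> colours is proper, as a simple graph has no loops.\<close>

lemma chromatic_number_attained:
  assumes "simple_graph V E"
  obtains f where "f \<in> V \<rightarrow> {..<chromatic_number V E}"
    "\<And>u v. u \<in> V \<Longrightarrow> v \<in> V \<Longrightarrow> {u, v} \<in> E \<Longrightarrow> f u \<noteq> f v"
proof -
  have "finite V" using assms by (simp add: simple_graph_def)
  then obtain g where g: "bij_betw g V {..<card V}"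
    using ex_bij_betw_finite_nat by (auto simp: atLeast0LessThan)
  have "colorable V E (card V)"
    unfolding colorable_def
  proof (intro bexI[of _ g] ballI impI)
    show "g u \<noteq> g v" if "u \<in> V" "v \<in> V" "{u, v} \<in> E" for u v
    proof -
      have "u \<noteq> v" using that(3) assms by (auto simp: simple_graph_def nsets_def)
      then show ?thesis using g that by (auto simp: bij_betw_def inj_on_def)
    qed
  qed (use g in \<open>auto simp: bij_betw_def\<close>)
  then have "colorable V E (chromatic_number V E)"
    unfolding chromatic_number_def by (rule LeastI)
  then show thesis using that unfolding colorable_def by blast
qed

text \<open>The classes of an optimal colouring cover \<open>V\<close>, and each is an independent
  set.\<close>

lemma card_le_independence_number_mult_chromatic_number:
  assumes "simple_graph V E"
  shows "card V \<le> independence_number V E * chromatic_number V E"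
proof -
  have fin: "finite V" using assms by (simp add: simple_graph_def)
  obtain f where f: "f \<in> V \<rightarrow> {..<chromatic_number V E}"
    and ne: "\<And>u v. u \<in> V \<Longrightarrow> v \<in> V \<Longrightarrow> {u, v} \<in> E \<Longrightarrow> f u \<noteq> f v"
    by (rule chromatic_number_attained[OF assms]) blast
  have "card V = card (\<Union>i<chromatic_number V E. {v \<in> V. f v = i})"
    using f by (intro arg_cong[where f = card]) auto
  also have "\<dots> \<le> (\<Sum>i<chromatic_number V E. card {v \<in> V. f v = i})"
    by (rule card_UN_le) simp
  also have "\<dots> \<le> (\<Sum>i<chromatic_number V E. independence_number V E)"
    by (intro sum_mono card_le_independence_number fin)
      (use ne in \<open>auto 0 3 simp: indep_def dest: sym\<close>)
  finally show ?thesis by (simp add: mult.commute)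
qed

section \<open>Reaching a prescribed chromatic number by deleting edges\<close>

text \<open>Recolouring one endpoint of the new edge with a fresh colour keeps the colouring
  proper.\<close>

lemma chromatic_number_insert_edge:
  assumes "simple_graph V E" "e \<in> [V]\<^bsup>2\<^esup>"
  shows "chromatic_number V (insert e E) \<le> Suc (chromatic_number V E)"
proof -
  obtain a b where e: "e = {a, b}" "a \<noteq> b" "a \<in> V" "b \<in> V"
    using assms(2) by (auto simp: nsets_def card_2_iff)
  obtain f where f: "f \<in> V \<rightarrow> {..<chromatic_number V E}"
    and ne: "\<And>u v. u \<in> V \<Longrightarrow> v \<in> V \<Longrightarrow> {u, v} \<in> E \<Longrightarrow> f u \<noteq> f v"
    by (rule chromatic_number_attained[OF assms(1)]) blast
  \<comment> \<open>The value \<open>chromatic_number V E\<close> is fresh, since all values of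
    \<open>f\<close> on \<open>V\<close> lie strictly below it.\<close>
  let ?g = "f(a := chromatic_number V E)"
  have loop: "{a} \<notin> E"
    using assms(1) by (auto simp: simple_graph_def nsets_def)
  have fin: "finite V" using assms(1) by (simp add: simple_graph_def)
  have less: "f v < chromatic_number V E" if "v \<in> V" for v using f that by auto
  have "chromatic_number V (insert e E) \<le> card (?g ` V)"
  proof (rule chromatic_number_le_card_image[OF fin])
    fix u v assume uv: "u \<in> V" "v \<in> V" "{u, v} \<in> insert e E"
    show "?g u \<noteq> ?g v"
      using uv e ne[of u v] less[of u] less[of v] loop by (auto simp: doubleton_eq_iff)
  qed
  also have "\<dots> \<le> card {..chromatic_number V E}"
    using less by (intro card_mono) (auto simp: less_imp_le)
  finally show ?thesis by simp
qed

text \<open>A discrete intermediate value argument: when edges are added one at a time, the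
  chromatic number rises by at most one per step and so cannot jump over \<open>c\<close>.\<close>

lemma ex_subgraph_chromatic_number_eq:
  assumes "simple_graph V E" "0 < c" "c \<le> chromatic_number V E"
  shows "\<exists>E' \<subseteq> E. chromatic_number V E' = c"
proof -
  have V: "finite V" and E: "E \<subseteq> [V]\<^bsup>2\<^esup>"
    using assms(1) by (auto simp: simple_graph_def)
  have "finite E" using E V by (meson finite_imp_finite_nsets finite_subset)
  then show ?thesis
    using E assms(3)
  proof (induction E)
    case empty
    \<comment> \<open>A constant colouring bounds the chromatic number by 1, so \<open>0 < c\<close>
      and \<open>c \<le> chromatic_number V {}\<close> force both to equal 1.\<close>
    have "chromatic_number V {} \<le> card ((\<lambda>_. 0 :: nat) ` V)"
      by (rule chromatic_number_le_card_image) (use V in auto)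
    also have "\<dots> \<le> card {0 :: nat}" by (rule card_mono) auto
    finally show ?case using empty assms(2) by (intro exI[of _ "{}"]) auto
  next
    case (insert e E)
    have "simple_graph V E" using V insert.prems by (simp add: simple_graph_def)
    then have "chromatic_number V (insert e E) \<le> Suc (chromatic_number V E)"
      using insert.prems by (intro chromatic_number_insert_edge) auto
    \<comment> \<open>Either the graph without \<open>e\<close> still reaches \<open>c\<close> and
      the induction hypothesis applies, or the present graph has chromatic number exactly
      \<open>c\<close>.\<close>
    then consider "c \<le> chromatic_number V E" | "chromatic_number V (insert e E) = c"
      using insert.prems by linarith
    then show ?case
      using insert.IH insert.prems by cases blast+
  qed
qed

text \<open>Relaxes the exact condition in \<open>Q_min\<close> to a lower bound on the chromatic
  number, so joins need only be estimated.\<close>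

lemma Q_min_le_clique_number:
  fixes V :: "nat set"
  assumes "simple_graph V E" "0 < c" "c \<le> chromatic_number V E"
  shows "Q_min (card V) c \<le> clique_number V E"
proof -
  obtain E' where E': "E' \<subseteq> E" "chromatic_number V E' = c"
    using ex_subgraph_chromatic_number_eq[OF assms] by blast
  then have "simple_graph V E'" using assms(1) by (auto simp: simple_graph_def)
  then have "Q_min (card V) c \<le> clique_number V E'"
    unfolding Q_min_def by (intro Least_le) (use E' in blast)
  also have "\<dots> \<le> clique_number V E"
    using assms(1) E'(1) by (intro clique_number_mono) (auto simp: simple_graph_def)
  finally show ?thesis .
qed

section \<open>The join of two graphs\<close>

text \<open>Even numbers carry the first graph and odd numbers the second. This makes the copies
  disjoint while staying inside \<open>nat\<close>, the vertex type fixed by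
  \<open>omega_min\<close> and \<open>Q_min\<close>.\<close>

definition join_edges :: "nat set \<Rightarrow> nat set set \<Rightarrow> nat set \<Rightarrow> nat set set \<Rightarrow> nat set set" where
  "join_edges V E W F =
     (\<lambda>e. (\<lambda>x. 2 * x) ` e) ` E \<union> (\<lambda>e. (\<lambda>x. 2 * x + 1) ` e) ` F \<union>
     {{2 * u, 2 * v + 1} | u v. u \<in> V \<and> v \<in> W}"

definition join_vertices :: "nat set \<Rightarrow> nat set \<Rightarrow> nat set" where
  "join_vertices V W = (\<lambda>x. 2 * x) ` V \<union> (\<lambda>x. 2 * x + 1) ` W"

lemma card_join_vertices:
  assumes "finite V" "finite W"
  shows "card (join_vertices V W) = card V + card W"
proof -
  have "card (join_vertices V W) = card ((\<lambda>x. 2 * x) ` V) + card ((\<lambda>x. 2 * x + 1) ` W)"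
    unfolding join_vertices_def
    by (rule card_Un_disjoint) (use assms in \<open>auto, presburger\<close>)
  then show ?thesis by (simp add: card_image inj_on_def)
qed

lemma simple_graph_join:
  assumes "simple_graph V E" "simple_graph W F"
  shows "simple_graph (join_vertices V W) (join_edges V E W F)"
proof -
  have "2 * u \<noteq> 2 * v + 1" for u v :: nat by presburger
  moreover have "card ((\<lambda>x. 2 * x) ` e) = card e" "card ((\<lambda>x. 2 * x + 1) ` e) = card e"
    for e :: "nat set"
    by (auto simp: card_image inj_on_def)
  ultimately show ?thesis
    using assms unfolding simple_graph_def join_edges_def join_vertices_def nsets_def
    by (auto 0 3 simp: card_insert_if)
qed

text \<open>By parity, an edge with two even ends can come only from the copy of \<open>E\<close>,
  and doubling is injective on sets.\<close>

lemma join_edges_left_iff: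
  "{2 * u, 2 * v} \<in> join_edges V E W F \<longleftrightarrow> {u, v} \<in> E"
proof
  have odd: "2 * x \<noteq> 2 * y + 1" "2 * x \<noteq> Suc (2 * y)" for x y :: nat by presburger+
  have inj: "inj (\<lambda>x :: nat. 2 * x)" by (simp add: inj_def)
  have img: "{2 * u, 2 * v} = (\<lambda>x. 2 * x) ` {u, v}" by simp
  show "{2 * u, 2 * v} \<in> join_edges V E W F" if "{u, v} \<in> E"
    unfolding join_edges_def img using that by blast
  assume "{2 * u, 2 * v} \<in> join_edges V E W F"
  then consider e where "e \<in> E" "{2 * u, 2 * v} = (\<lambda>x. 2 * x) ` e"
    | e where "e \<in> F" "{2 * u, 2 * v} = (\<lambda>x. 2 * x + 1) ` e"
    | x y where "{2 * u, 2 * v} = {2 * x, 2 * y + 1}"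
    unfolding join_edges_def by blast
  then show "{u, v} \<in> E"
  proof cases
    case 1
    then show ?thesis unfolding img using inj by (metis inj_image_eq_iff)
  next
    case 2
    then have "2 * u \<in> (\<lambda>x. 2 * x + 1) ` e" by blast
    then show ?thesis using odd by blast
  next
    case 3
    then have "2 * y + 1 \<in> {2 * u, 2 * v}" by blast
    then show ?thesis using odd[symmetric] by auto
  qed
qed

lemma join_edges_right_iff:
  "{2 * u + 1, 2 * v + 1} \<in> join_edges V E W F \<longleftrightarrow> {u, v} \<in> F"
proof
  have odd: "2 * x \<noteq> 2 * y + 1" "2 * x \<noteq> Suc (2 * y)" for x y :: nat by presburger+
  have inj: "inj (\<lambda>x :: nat. 2 * x + 1)" by (simp add: inj_def)
  have img: "{2 * u + 1, 2 * v + 1} = (\<lambda>x. 2 * x + 1) ` {u, v}" by simp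
  show "{2 * u + 1, 2 * v + 1} \<in> join_edges V E W F" if "{u, v} \<in> F"
    unfolding join_edges_def img using that by blast
  assume "{2 * u + 1, 2 * v + 1} \<in> join_edges V E W F"
  then consider e where "e \<in> F" "{2 * u + 1, 2 * v + 1} = (\<lambda>x. 2 * x + 1) ` e"
    | e where "e \<in> E" "{2 * u + 1, 2 * v + 1} = (\<lambda>x. 2 * x) ` e"
    | x y where "{2 * u + 1, 2 * v + 1} = {2 * x, 2 * y + 1}"
    unfolding join_edges_def by blast
  then show "{u, v} \<in> F"
  proof cases
    case 1
    then show ?thesis unfolding img using inj by (metis inj_image_eq_iff)
  next
    case 2
    then have "2 * u + 1 \<in> (\<lambda>x. 2 * x) ` e" by blast
    then show ?thesis using odd[symmetric] by blast
  next
    case 3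
    then have "2 * x \<in> {2 * u + 1, 2 * v + 1}" by blast
    then show ?thesis using odd by auto
  qed
qed

text \<open>Splitting a clique of the join by parity yields a clique in each of the two
  graphs.\<close>

lemma clique_number_join_le:
  assumes "simple_graph V E" "simple_graph W F"
  shows "clique_number (join_vertices V W) (join_edges V E W F)
    \<le> clique_number V E + clique_number W F"
proof (rule clique_number_le)
  have fin: "finite V" "finite W" using assms by (auto simp: simple_graph_def)
  then show "finite (join_vertices V W)" by (simp add: join_vertices_def)
  fix K assume K: "K \<subseteq> join_vertices V W" "clique K (join_edges V E W F)"
  let ?A = "{v \<in> V. 2 * v \<in> K}" and ?B = "{v \<in> W. 2 * v + 1 \<in> K}"
  have "K \<subseteq> join_vertices ?A ?B" using K(1) by (auto simp: join_vertices_def)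
  then have "card K \<le> card (join_vertices ?A ?B)"
    using fin by (intro card_mono) (auto simp: join_vertices_def)
  also have "\<dots> = card ?A + card ?B" using fin by (intro card_join_vertices) auto
  also have "\<dots> \<le> clique_number V E + clique_number W F"
  proof (intro add_mono card_le_clique_number fin)
    show "clique ?A E"
      unfolding clique_def
    proof (intro ballI impI)
      fix u v assume "u \<in> ?A" "v \<in> ?A" "u \<noteq> v"
      then have "{2 * u, 2 * v} \<in> join_edges V E W F"
        using K(2) unfolding clique_def by simp
      then show "{u, v} \<in> E" using join_edges_left_iff by simp
    qed
    show "clique ?B F"
      unfolding clique_def
    proof (intro ballI impI)
      fix u v assume "u \<in> ?B" "v \<in> ?B" "u \<noteq> v"
      then have "{2 * u + 1, 2 * v + 1} \<in> join_edges V E W F"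
        using K(2) unfolding clique_def by simp
      then show "{u, v} \<in> F" using join_edges_right_iff by simp
    qed
  qed auto
  finally show "card K \<le> clique_number V E + clique_number W F" .
qed

text \<open>A proper colouring of the join restricts to proper colourings of both sides, and these
  share no colour because all cross edges are present.\<close>

lemma chromatic_number_join_ge:
  assumes "simple_graph V E" "simple_graph W F"
  shows "chromatic_number V E + chromatic_number W F
    \<le> chromatic_number (join_vertices V W) (join_edges V E W F)"
proof -
  let ?c = "chromatic_number (join_vertices V W) (join_edges V E W F)"
  have fin: "finite V" "finite W" using assms by (auto simp: simple_graph_def)
  obtain f where f: "f \<in> join_vertices V W \<rightarrow> {..<?c}"
    and ne: "\<And>u v. u \<in> join_vertices V W \<Longrightarrow> v \<in> join_vertices V W \<Longrightarrow>
      {u, v} \<in> join_edges V E W F \<Longrightarrow> f u \<noteq> f v"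
    by (rule chromatic_number_attained[OF simple_graph_join[OF assms]]) blast
  let ?f = "\<lambda>x. f (2 * x)" and ?g = "\<lambda>x. f (2 * x + 1)"
  have mem: "v \<in> V \<Longrightarrow> 2 * v \<in> join_vertices V W"
    "v \<in> W \<Longrightarrow> 2 * v + 1 \<in> join_vertices V W" for v
    by (auto simp: join_vertices_def)
  have "chromatic_number V E \<le> card (?f ` V)"
    by (rule chromatic_number_le_card_image[OF fin(1)], rule ne)
      (use mem join_edges_left_iff in auto)
  moreover have "chromatic_number W F \<le> card (?g ` W)"
    by (rule chromatic_number_le_card_image[OF fin(2)], rule ne)
      (use mem join_edges_right_iff in auto)
  moreover have "card (?f ` V) + card (?g ` W) = card (?f ` V \<union> ?g ` W)"
  proof (rule card_Un_disjoint[symmetric])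
    have "f (2 * u) \<noteq> f (2 * v + 1)" if "u \<in> V" "v \<in> W" for u v
      by (rule ne) (use mem that in \<open>auto simp: join_edges_def\<close>)
    then show "?f ` V \<inter> ?g ` W = {}" by blast
  qed (use fin in auto)
  moreover have "card (?f ` V \<union> ?g ` W) \<le> card {..<?c}"
    by (rule card_mono) (use f mem in auto)
  ultimately show ?thesis by simp
qed

section \<open>Assembling the extremal graphs\<close>

text \<open>The invariants are only bounded, in the directions that
  \<open>Q_min_le_clique_number\<close> uses; such bounds add up under joins.\<close>

definition realizable :: "nat \<Rightarrow> nat \<Rightarrow> nat \<Rightarrow> bool" where
  "realizable n c s \<longleftrightarrow>
     (\<exists>(V :: nat set) E. simple_graph V E \<and> card V = n \<and>
        c \<le> chromatic_number V E \<and> clique_number V E \<le> s)"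

lemma realizable_0: "realizable 0 0 0"
proof -
  have "clique_number {} {} \<le> (0 :: nat)" by (rule clique_number_le) auto
  then show ?thesis
    unfolding realizable_def by (intro exI[of _ "{}"]) (simp add: simple_graph_def)
qed

lemma realizable_add:
  assumes "realizable n c s" "realizable n' c' s'"
  shows "realizable (n + n') (c + c') (s + s')"
proof -
  obtain V :: "nat set" and E where VE: "simple_graph V E" "card V = n" "c \<le> chromatic_number V E"
      "clique_number V E \<le> s"
    using assms(1) unfolding realizable_def by blast
  obtain W :: "nat set" and F where WF: "simple_graph W F" "card W = n'" "c' \<le> chromatic_number W F"
      "clique_number W F \<le> s'"
    using assms(2) unfolding realizable_def by blast
  have "card (join_vertices V W) = n + n'"
    using VE WF card_join_vertices by (simp add: simple_graph_def)
  then show ?thesis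
    unfolding realizable_def
    using simple_graph_join[OF VE(1) WF(1)] clique_number_join_le[OF VE(1) WF(1)]
      chromatic_number_join_ge[OF VE(1) WF(1)] VE WF
    by (intro exI[of _ "join_vertices V W"] exI[of _ "join_edges V E W F"]) linarith
qed

text \<open>An extremal graph for \<open>omega_min\<close> serves: its colour classes have at most
  \<open>k\<close> vertices, so covering \<open>k * x\<close> vertices takes at least
  \<open>x\<close> of them.\<close>

lemma realizable_omega_min:
  assumes "0 < k"
  shows "realizable (k * x) x (omega_min (k * x) k)"
proof -
  obtain V :: "nat set" and E where VE: "simple_graph V E" "card V = k * x"
      "independence_number V E \<le> k" "omega_min (k * x) k = clique_number V E"
    using omega_min_attained[OF assms, of "k * x"] by blast
  have "k * x \<le> independence_number V E * chromatic_number V E"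
    using card_le_independence_number_mult_chromatic_number[OF VE(1)] VE(2) by simp
  also have "\<dots> \<le> k * chromatic_number V E" using VE(3) by (rule mult_le_mono1)
  finally have "x \<le> chromatic_number V E" using assms by simp
  then show ?thesis unfolding realizable_def using VE by auto
qed

text \<open>Join one extremal graph for each part of an optimal partition of \<open>b\<close>, by
  induction on the multiset of parts.\<close>

lemma realizable_q_min:
  assumes "0 < k"
  shows "realizable (k * b) b (q_min b k)"
proof -
  obtain B :: "nat multiset" where B: "\<Sum>\<^sub># B = b"
      "q_min b k = (\<Sum>x\<in>#B. omega_min (k * x) k)"
    using q_min_attained by blast
  have "realizable (k * \<Sum>\<^sub># B) (\<Sum>\<^sub># B) (\<Sum>x\<in>#B. omega_min (k * x) k)"
  proof (induction B)
    case empty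
    show ?case by (simp add: realizable_0)
  next
    case (add x B)
    show ?case
      using realizable_add[OF realizable_omega_min[OF assms, of x] add.IH]
      by (simp add: distrib_left)
  qed
  with B show ?thesis by simp
qed

theorem theorem3p1:
  fixes r :: real and k :: nat and l m :: "nat \<Rightarrow> nat"
  assumes "0 < r" and "r \<le> 1" and "1 / r \<notin> \<int>"
    and "k = nat \<lfloor>1 / r\<rfloor>"
    and "\<And>n. m n = n - k * nat \<lceil>r * real n\<rceil>"
    and "\<And>n. l n = (k + 1) * nat \<lceil>r * real n\<rceil> - n"
  shows "\<forall>\<^sub>F n in sequentially.
           Q_min n (nat \<lceil>r * real n\<rceil>) \<le> q_min (l n) k + q_min (m n) (k + 1)"
  using eventually_l_m_positive[OF assms(1-4)]
proof eventually_elim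
  case (elim n)
  let ?c = "nat \<lceil>r * real n\<rceil>"
  have "1 \<le> 1 / r" using assms(1,2) by simp
  then have k: "0 < k" unfolding assms(4) by linarith
  \<comment> \<open>The strict inequalities in \<open>elim\<close> make the truncated subtractions
    in \<open>m\<close> and \<open>l\<close> exact.\<close>
  have m: "m n + k * ?c = n" using elim assms(5) by simp
  have l: "l n + n = (k + 1) * ?c" using elim assms(6) by simp
  have lm: "l n + m n = ?c" using m l by (simp add: algebra_simps)
  \<comment> \<open>The vertex count of the final join: \<open>l n\<close> blocks of
    \<open>k\<close> vertices and \<open>m n\<close> blocks of \<open>k + 1\<close>.\<close>
  have "k * l n + (k + 1) * m n = k * (l n + m n) + m n" by (simp add: algebra_simps)
  also have "\<dots> = n" using m lm by simp
  finally have "realizable n ?c (q_min (l n) k + q_min (m n) (k + 1))"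
    using realizable_add[OF realizable_q_min[OF k] realizable_q_min[of "k + 1"]] lm
    by (metis add_gr_0 zero_less_one)
  then obtain V :: "nat set" and E where "simple_graph V E" "card V = n"
      "?c \<le> chromatic_number V E"
      "clique_number V E \<le> q_min (l n) k + q_min (m n) (k + 1)"
    unfolding realizable_def by blast
  \<comment> \<open>If \<open>?c\<close> were 0, then \<open>n < (k + 1) * ?c\<close> would
    fail.\<close>
  moreover have "0 < ?c" using elim by (cases ?c) auto
  ultimately show ?case using Q_min_le_clique_number[of V E ?c] by auto
qed

end
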